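(* Let $g,h$ be non-negative integers, and let $R$ be a set of $3g+h$ red points and $B$ a set of $3h+g$ blue points in the plane such that $R\cup B$ is in general position and there is a line separating $R$ from $B$ (i.e., $R$ lies in one open half-plane of the line and $B$ in the other). Then all points of $R\cup B$ can be $K_{1,3}$-covered.
   Context: General position: no three points collinear. A set $X$ of red and blue points can be $K_{1,3}$-covered if $X$ can be partitioned into subsets of size $4$, each consisting of one point (the center) of one color and three points of the other color, such that the straight-line segments joining each center to the three other points of its subset are pairwise non-crossing (no two of these segments intersect except at a common endpoint). *)

theory Defs
  imports "HOL-Analysis.Analysis" "HOL-Library.Disjoint_Sets"
begin

definition general_position :: "(real^2) set \<Rightarrow> bool" where
  "general_position X \<longleftrightarrow> (\<forall>T\<subseteq>X. card T = 3 \<longrightarrow> \<not> collinear T)"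

definition line_separates :: "real^2 \<Rightarrow> real \<Rightarrow> (real^2) set \<Rightarrow> (real^2) set \<Rightarrow> bool" where
  "line_separates v t R B \<longleftrightarrow>
     v \<noteq> 0 \<and> (\<forall>x\<in>R. v \<bullet> x < t) \<and> (\<forall>y\<in>B. v \<bullet> y > t)"

definition k13_block :: "(real^2) set \<Rightarrow> (real^2) set \<Rightarrow> (real^2) set \<Rightarrow> real^2 \<Rightarrow> bool" where
  "k13_block R B S c \<longleftrightarrow>
     card S = 4 \<and> c \<in> S \<and> (c \<in> R \<and> S - {c} \<subseteq> B \<or> c \<in> B \<and> S - {c} \<subseteq> R)"

text \<open>A segment is represented by the pair of its endpoints.\<close>

definition non_crossing :: "(real^2) \<times> (real^2) \<Rightarrow> (real^2) \<times> (real^2) \<Rightarrow> bool" where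
  "non_crossing e f \<longleftrightarrow>
     closed_segment (fst e) (snd e) \<inter> closed_segment (fst f) (snd f)
       \<subseteq> {fst e, snd e} \<inter> {fst f, snd f}"

definition star_segments :: "(real^2) set set \<Rightarrow> ((real^2) set \<Rightarrow> real^2) \<Rightarrow> ((real^2) \<times> (real^2)) set" where
  "star_segments P ctr = {(ctr S, x) |S x. S \<in> P \<and> x \<in> S - {ctr S}}"

text \<open>Non-crossing is required of the segments of all blocks taken together.\<close>

definition k13_coverable :: "(real^2) set \<Rightarrow> (real^2) set \<Rightarrow> bool" where
  "k13_coverable R B \<longleftrightarrow>
     (\<exists>P ctr. partition_on (R \<union> B) P \<and> (\<forall>S\<in>P. k13_block R B S (ctr S)) \<and>
        pairwise non_crossing (star_segments P ctr))"

end

theory Submission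
  imports Defs
begin

text \<open>
  If \<open>g > 0\<close>, some half-plane contains exactly four of the points, three red and one blue; its
  star is removed and the argument is repeated on the other points, whose convex hull is disjoint
  from that of the star. To find the half-plane, rotate a direction \<open>u\<close> and look at the four
  extreme points in direction \<open>u\<close>. When \<open>u\<close> is one normal of the separating line there are at least
  three red ones among them, and at most three when \<open>u\<close> is the other normal. The number of red
  points changes by at most one at a time because no line contains three points, so it is three for
  some \<open>u\<close>. The case \<open>h > 0\<close> is symmetric.
\<close>

section \<open>Half-plane cuts of a finite point set\<close>

text \<open>The inequality is non-strict so that ties on the boundary line may be broken either way:
  every size is attained in every direction, and for fixed \<open>A\<close> the admissible
  directions \<open>u\<close> form a closed set.\<close>

definition weakly_cut_off :: "'a::real_inner set \<Rightarrow> 'a \<Rightarrow> 'a set \<Rightarrow> bool" where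
  "weakly_cut_off X u A \<longleftrightarrow> A \<subseteq> X \<and> (\<forall>a\<in>A. \<forall>b\<in>X - A. u \<bullet> a \<le> u \<bullet> b)"

lemma weakly_cut_off_exists:
  assumes "finite X" "k \<le> card X"
  shows "\<exists>A. weakly_cut_off X u A \<and> card A = k"
  using assms(2)
proof (induction k)
  case 0
  show ?case by (rule exI[of _ "{}"]) (simp add: weakly_cut_off_def)
next
  case (Suc k)
  then obtain A where A: "weakly_cut_off X u A" "card A = k" by auto
  then have fin: "finite A" "A \<subseteq> X"
    using assms(1) finite_subset by (auto simp: weakly_cut_off_def)
  have "X - A \<noteq> {}"
  proof
    assume "X - A = {}"
    then have "A = X" using fin(2) by blast
    then show False using A(2) Suc.prems by simp
  qed
  then obtain m where m: "m \<in> X - A" "\<And>b. b \<in> X - A \<Longrightarrow> u \<bullet> m \<le> u \<bullet> b"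
    using ex_is_arg_min_if_finite[of "X - A" "\<lambda>x. u \<bullet> x"] assms(1)
    by (auto simp: is_arg_min_linorder)
  have "weakly_cut_off X u (insert m A)"
    using A(1) m by (auto simp: weakly_cut_off_def)
  moreover have "card (insert m A) = Suc k"
    using m fin A(2) by simp
  ultimately show ?case by blast
qed

lemma general_position_subset: "general_position Y" if "general_position X" "Y \<subseteq> X"
  using that by (auto simp: general_position_def)

lemma general_position_not_collinear:
  assumes "general_position X" "{a, b, c} \<subseteq> X" "a \<noteq> b" "b \<noteq> c" "a \<noteq> c"
  shows "\<not> collinear {a, b, c}"
  using assms by (simp add: general_position_def)

lemma general_position_card_on_line:
  fixes u :: "real^2"
  assumes "general_position X" "u \<noteq> 0" "T \<subseteq> X" "\<And>x. x \<in> T \<Longrightarrow> u \<bullet> x = s"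
  shows "card T \<le> 2"
proof (rule ccontr)
  assume "\<not> card T \<le> 2"
  then obtain T' where T': "T' \<subseteq> T" "card T' = 3"
    by (metis not_less_eq_eq numeral_2_eq_2 numeral_3_eq_3 obtain_subset_with_card_n)
  have "T' \<subseteq> {x. u \<bullet> x = s}" using T' assms by auto
  then have "aff_dim T' \<le> aff_dim {x. u \<bullet> x = s}" by (rule aff_dim_subset)
  also have "\<dots> = 1" using aff_dim_hyperplane[OF assms(2), of s] by simp
  finally have "collinear T'" by (simp add: collinear_aff_dim)
  then show False using assms(1,3) T' by (auto simp: general_position_def)
qed

text \<open>Lets a weak cut serve as a genuine separation, so that a star inside \<open>A\<close>
  cannot meet segments between the other points.\<close>

lemma weakly_cut_off_disjoint_hulls:
  fixes X :: "(real^2) set"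
  assumes "finite X" "general_position X" "u \<noteq> 0" "weakly_cut_off X u A"
  shows "convex hull A \<inter> convex hull (X - A) = {}"
proof (cases "A = {}")
  case False
  have A: "A \<subseteq> X" "\<And>a b. a \<in> A \<Longrightarrow> b \<in> X - A \<Longrightarrow> u \<bullet> a \<le> u \<bullet> b"
    using assms(4) by (auto simp: weakly_cut_off_def)
  then have fin: "finite A" using assms(1) finite_subset by blast
  \<comment> \<open>Two tied pairs lie on the same line, as \<open>u \<bullet> a \<le> u \<bullet> q
    = u \<bullet> p \<le> u \<bullet> b = u \<bullet> a\<close>. Distinct pairs would put at least
    three points on it.\<close>
  have unique: "a = p \<and> b = q"
    if "a \<in> A" "b \<in> X - A" "u \<bullet> a = u \<bullet> b" "p \<in> A" "q \<in> X - A" "u \<bullet> p = u \<bullet> q" for a b p q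
  proof (rule ccontr)
    assume neq: "\<not> (a = p \<and> b = q)"
    have "u \<bullet> a \<le> u \<bullet> q" "u \<bullet> p \<le> u \<bullet> b" using that by (blast intro: A(2))+
    then have "u \<bullet> x = u \<bullet> p" if "x \<in> {a, b, p, q}" for x
      using that \<open>u \<bullet> a = u \<bullet> b\<close> \<open>u \<bullet> p = u \<bullet> q\<close> by auto
    then have "card {a, b, p, q} \<le> 2"
      using general_position_card_on_line[OF assms(2,3), of "{a, b, p, q}"] that A(1) by blast
    moreover have "card {a, b, p, q} \<ge> 3"
      using that neq by (auto simp: card_insert_if)
    ultimately show False by simp
  qed
  \<comment> \<open>At most one pair lies on the boundary line; tilting \<open>u\<close> along it makes the cut strict.\<close>
  obtain w where w: "\<And>a b. a \<in> A \<Longrightarrow> b \<in> X - A \<Longrightarrow> u \<bullet> a = u \<bullet> b \<Longrightarrow> w \<bullet> a < w \<bullet> b"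
  proof (cases "\<exists>p\<in>A. \<exists>q\<in>X - A. u \<bullet> p = u \<bullet> q")
    case True
    then obtain p q where pq: "p \<in> A" "q \<in> X - A" "u \<bullet> p = u \<bullet> q" by blast
    then have "(q - p) \<bullet> (q - p) > 0" by auto
    then have "(q - p) \<bullet> p < (q - p) \<bullet> q" by (simp add: inner_diff_right)
    then show ?thesis using that[of "q - p"] unique pq by metis
  next
    case False
    then show ?thesis using that by blast
  qed
  \<comment> \<open>For small positive \<open>e\<close> the term in \<open>w\<close> decides a tied
    pair, and every strict inequality survives by continuity. There are finitely many pairs, so one
    \<open>e\<close> serves them all.\<close>
  have "eventually (\<lambda>e. (u + e *\<^sub>R w) \<bullet> a < (u + e *\<^sub>R w) \<bullet> b) (at_right (0::real))"
    if ab: "a \<in> A" "b \<in> X - A" for a b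
  proof (cases "u \<bullet> a = u \<bullet> b")
    case True
    then have "w \<bullet> a < w \<bullet> b" using w ab by blast
    then show ?thesis using True
      by (intro eventually_mono[OF eventually_at_right_less[of 0]]) (simp add: inner_add_left)
  next
    case False
    then have "u \<bullet> a < u \<bullet> b" using A(2)[OF ab] by simp
    moreover have "((\<lambda>e. (u + e *\<^sub>R w) \<bullet> b - (u + e *\<^sub>R w) \<bullet> a) \<longlongrightarrow> u \<bullet> b - u \<bullet> a) (at_right 0)"
      by (auto intro!: tendsto_eq_intros)
    ultimately have "eventually (\<lambda>e. 0 < (u + e *\<^sub>R w) \<bullet> b - (u + e *\<^sub>R w) \<bullet> a) (at_right 0)"
      by (intro order_tendstoD(1)) auto
    then show ?thesis by (rule eventually_mono) simp
  qed
  then have "eventually (\<lambda>e. \<forall>(a, b)\<in>A \<times> (X - A). (u + e *\<^sub>R w) \<bullet> a < (u + e *\<^sub>R w) \<bullet> b) (at_right (0::real))"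
    using fin assms(1) by (intro eventually_ball_finite) auto
  then obtain e where "\<forall>(a, b)\<in>A \<times> (X - A). (u + e *\<^sub>R w) \<bullet> a < (u + e *\<^sub>R w) \<bullet> b"
    using eventually_happens'[of "at_right (0::real)"] by auto
  then obtain z where z: "\<And>a b. a \<in> A \<Longrightarrow> b \<in> X - A \<Longrightarrow> z \<bullet> a < z \<bullet> b" by auto
  define m where "m = Max ((\<bullet>) z ` A)"
  have "m \<in> (\<bullet>) z ` A" using fin False by (simp add: m_def)
  then have "X - A \<subseteq> {x. z \<bullet> x > m}" using z by auto
  then have "convex hull (X - A) \<subseteq> {x. z \<bullet> x > m}"
    by (intro hull_minimal convex_halfspace_gt) auto
  moreover have "A \<subseteq> {x. z \<bullet> x \<le> m}" using fin by (auto simp: m_def)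
  then have "convex hull A \<subseteq> {x. z \<bullet> x \<le> m}"
    by (intro hull_minimal convex_halfspace_le) auto
  ultimately show ?thesis by fastforce
qed simp

section \<open>Finding three red points and one blue point\<close>

text \<open>The rotation is replaced by connectedness of the punctured plane: the closed sets of
  directions that admit a cut with at most, respectively at least, three red points are both met and
  cover it, so they share a direction. Two such cuts in one direction differ only by ties, hence by
  at most one exchange.\<close>

lemma weakly_cut_off_card_three:
  fixes R B :: "(real^2) set"
  assumes "finite R" "finite B" "general_position (R \<union> B)" "line_separates v t R B"
    and "card R \<ge> 3" "card B \<ge> 1"
  obtains u A where "u \<noteq> 0" "weakly_cut_off (R \<union> B) u A" "card A = 4" "card (A \<inter> R) = 3"
proof -
  let ?X = "R \<union> B"
  have v: "v \<noteq> 0" "\<And>x y. x \<in> R \<Longrightarrow> y \<in> B \<Longrightarrow> v \<bullet> x < v \<bullet> y"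
    using assms(4) by (fastforce simp: line_separates_def)+
  then have disj: "R \<inter> B = {}" by blast
  have finX: "finite ?X" using assms by simp
  have card4: "card ?X \<ge> 4" using card_Un_disjoint[OF assms(1,2) disj] assms(5,6) by simp
  define cuts where "cuts Q = {u. \<exists>A\<in>{A. A \<subseteq> ?X \<and> card A = 4 \<and> Q (card (A \<inter> R))}. weakly_cut_off ?X u A}"
    for Q :: "nat \<Rightarrow> bool"
  \<comment> \<open>Each \<open>A\<close> contributes an intersection of closed half-planes of
    directions, and \<open>?X\<close> has only finitely many subsets.\<close>
  have closed_cuts: "closed (cuts Q)" for Q
  proof -
    have "closed {u. weakly_cut_off ?X u A}" if "A \<subseteq> ?X" for A
    proof -
      have "{u. weakly_cut_off ?X u A} = (\<Inter>a\<in>A. \<Inter>b\<in>?X - A. {u. u \<bullet> a \<le> u \<bullet> b})"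
        using that by (auto simp: weakly_cut_off_def)
      then show ?thesis by (auto intro!: closed_INT closed_Collect_le continuous_intros)
    qed
    then have "closed (\<Union>A\<in>{A. A \<subseteq> ?X \<and> card A = 4 \<and> Q (card (A \<inter> R))}. {u. weakly_cut_off ?X u A})"
      using finX by (intro closed_UN) auto
    then show ?thesis
      by (rule back_subst[where P = closed]) (auto simp: cuts_def)
  qed
  let ?few = "cuts (\<lambda>n. n \<le> 3)" and ?many = "cuts (\<lambda>n. n \<ge> 3)"
  have cut_ex: "\<exists>A. A \<subseteq> ?X \<and> card A = 4 \<and> weakly_cut_off ?X u A" for u
    using weakly_cut_off_exists[OF finX card4] by (metis weakly_cut_off_def)
  have cover: "- {0} \<subseteq> ?few \<union> ?many"
  proof
    fix u
    obtain A where "A \<subseteq> ?X" "card A = 4" "weakly_cut_off ?X u A" using cut_ex by blast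
    then show "u \<in> ?few \<union> ?many"
      using le_cases[of "card (A \<inter> R)" 3] by (auto simp: cuts_def)
  qed
  \<comment> \<open>Red points come first in direction \<open>v\<close>: a cut that omits a red
    point contains no blue one. So it consists of four red points or contains all of
    \<open>R\<close>.\<close>
  have "v \<in> ?many \<inter> - {0}"
  proof -
    obtain A where A: "A \<subseteq> ?X" "card A = 4" "weakly_cut_off ?X v A" using cut_ex by blast
    have "A \<subseteq> R \<or> R \<subseteq> A"
    proof (rule ccontr)
      assume "\<not> ?thesis"
      then obtain x y where xy: "x \<in> R" "x \<notin> A" "y \<in> A" "y \<in> B" using A(1) by blast
      then have "v \<bullet> y \<le> v \<bullet> x" using A(3) unfolding weakly_cut_off_def by blast
      then show False using v(2) xy by fastforce
    qed
    then have "card (A \<inter> R) \<ge> 3" using A(2) assms(5) by (auto simp: Int_absorb1 Int_absorb2)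
    then show ?thesis using A v(1) by (auto simp: cuts_def)
  qed
  \<comment> \<open>Blue points come first in direction \<open>- v\<close>, and \<open>B\<close> is
    nonempty, so at least one of the four points is blue.\<close>
  moreover have "- v \<in> ?few \<inter> - {0}"
  proof -
    obtain A where A: "A \<subseteq> ?X" "card A = 4" "weakly_cut_off ?X (- v) A" using cut_ex by blast
    have "A \<subseteq> B \<or> B \<subseteq> A"
    proof (rule ccontr)
      assume "\<not> ?thesis"
      then obtain x y where xy: "x \<in> B" "x \<notin> A" "y \<in> A" "y \<in> R" using A(1) by blast
      then have "(- v) \<bullet> y \<le> (- v) \<bullet> x" using A(3) unfolding weakly_cut_off_def by blast
      then show False using v(2) xy by fastforce
    qed
    moreover have "B \<noteq> {}" using assms(6) by auto
    moreover have "A \<noteq> {}" using A(2) by auto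
    ultimately have "A \<inter> R \<subset> A" using disj by blast
    then have "card (A \<inter> R) < 4" using A(2) by (metis card.infinite psubset_card_mono zero_neq_numeral)
    then show ?thesis using A v(1) by (auto simp: cuts_def)
  qed
  moreover have "connected (- {0 :: real^2})"
    by (rule connected_punctured_universe) simp
  ultimately have "?few \<inter> ?many \<inter> - {0} \<noteq> {}"
    using connected_closedD[of "- {0}" ?few ?many] closed_cuts cover by blast
  then obtain u where u: "u \<noteq> 0" "u \<in> ?few" "u \<in> ?many"
    by blast
  then obtain A A' where A: "card A = 4" "card (A \<inter> R) \<le> 3" "weakly_cut_off ?X u A"
    and A': "card A' = 4" "card (A' \<inter> R) \<ge> 3" "weakly_cut_off ?X u A'"
    unfolding cuts_def by blast
  show ?thesis
  proof (cases "card (A \<inter> R) = 3 \<or> card (A' \<inter> R) = 3")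
    case True
    then show ?thesis using that[OF u(1)] A A' by blast
  next
    case False
    \<comment> \<open>Otherwise the counts are at most 2 and at least 4. Then \<open>A'\<close> has
      two points outside \<open>A\<close> and, by equal size, \<open>A\<close> has two outside
      \<open>A'\<close>; all four will turn out to lie on one line.\<close>
    then have gap: "card (A \<inter> R) + 2 \<le> card (A' \<inter> R)" using A(2) A'(2) by linarith
    have fin: "finite A" "finite A'" using A(1) A'(1) by (auto intro: card_ge_0_finite)
    have "card (A' \<inter> R) \<le> card ((A \<inter> R) \<union> (A' - A))"
      using fin by (intro card_mono) auto
    also have "\<dots> \<le> card (A \<inter> R) + card (A' - A)" by (rule card_Un_le)
    finally have new: "card (A' - A) \<ge> 2" using gap by simp
    moreover have "card (A - A') = card (A' - A)"
      using card_Diff_subset_Int[of A A'] card_Diff_subset_Int[of A' A] fin A(1) A'(1)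
      by (simp add: Int_commute)
    moreover have "card ((A - A') \<union> (A' - A)) = card (A - A') + card (A' - A)"
      using fin by (intro card_Un_disjoint) auto
    ultimately have "card ((A - A') \<union> (A' - A)) \<ge> 4" by simp
    \<comment> \<open>Each cut contains exactly one of \<open>a\<close> and \<open>a'\<close>, which
      gives the two opposite inequalities.\<close>
    moreover have eq: "u \<bullet> a = u \<bullet> a'" if "a \<in> A - A'" "a' \<in> A' - A" for a a'
    proof -
      have "a \<in> ?X" "a' \<in> ?X" using that A(3) A'(3) by (auto simp: weakly_cut_off_def)
      then show ?thesis using that A(3) A'(3) unfolding weakly_cut_off_def
        by (meson DiffD1 DiffD2 DiffI order_antisym)
    qed
    obtain a a' where aa: "a \<in> A - A'" "a' \<in> A' - A"
      using new \<open>card (A - A') = card (A' - A)\<close>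
      by (metis card.empty equals0I not_numeral_le_zero)
    have "card ((A - A') \<union> (A' - A)) \<le> 2"
    proof (rule general_position_card_on_line[OF assms(3) u(1)])
      show "A - A' \<union> (A' - A) \<subseteq> ?X" using A(3) A'(3) by (auto simp: weakly_cut_off_def)
      show "u \<bullet> x = u \<bullet> a" if "x \<in> A - A' \<union> (A' - A)" for x
        using that eq aa by (metis Un_iff)
    qed
    ultimately show ?thesis by simp
  qed
qed

section \<open>Adding a star to a cover\<close>

lemma k13_coverable_commute: "k13_coverable R B \<longleftrightarrow> k13_coverable B R"
  by (simp add: k13_coverable_def k13_block_def Un_commute disj_commute)

lemma line_separates_commute: "line_separates v t R B \<Longrightarrow> line_separates (- v) (- t) B R"
  by (auto simp: line_separates_def)

lemma line_separates_subset:
  "line_separates v t R B \<Longrightarrow> R' \<subseteq> R \<Longrightarrow> B' \<subseteq> B \<Longrightarrow> line_separates v t R' B'"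
  by (auto simp: line_separates_def)

lemma non_crossing_commute: "non_crossing e f \<longleftrightarrow> non_crossing f e"
  by (auto simp: non_crossing_def)

lemma non_crossing_if_disjoint_hulls:
  assumes "convex hull A \<inter> convex hull C = {}" "{a, b} \<subseteq> A" "{c, d} \<subseteq> C"
  shows "non_crossing (a, b) (c, d)"
proof -
  have "closed_segment a b \<subseteq> convex hull A" "closed_segment c d \<subseteq> convex hull C"
    using assms by (auto simp: segment_convex_hull intro!: hull_mono)
  then show ?thesis using assms(1) by (auto simp: non_crossing_def)
qed

text \<open>Segments of the new star and of the old cover lie in disjoint convex hulls. Two segments
  of the new star meet only in \<open>c\<close>, since \<open>c\<close> and their other ends are not
  collinear.\<close>

lemma k13_coverable_add_star:
  assumes gp: "general_position (R \<union> B)" and A: "A \<subseteq> R \<union> B" and block: "k13_block R B A c"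
    and hulls: "convex hull A \<inter> convex hull (R \<union> B - A) = {}"
    and rest: "k13_coverable (R - A) (B - A)"
  shows "k13_coverable R B"
proof -
  obtain P ctr where P: "partition_on (R \<union> B - A) P"
    "\<And>S. S \<in> P \<Longrightarrow> k13_block (R - A) (B - A) S (ctr S)"
    "pairwise non_crossing (star_segments P ctr)"
    using rest by (auto simp: k13_coverable_def Un_Diff)
  have cA: "c \<in> A" "A \<noteq> {}" using block by (auto simp: k13_block_def)
  have sub: "S \<subseteq> R \<union> B - A" if "S \<in> P" for S
    using P(1) that by (auto simp: partition_on_def)
  have ctrS: "ctr S \<in> S" if "S \<in> P" for S using P(2)[OF that] by (simp add: k13_block_def)
  \<comment> \<open>Hence redefining the center at \<open>A\<close> leaves the centers of the old
    blocks unchanged.\<close>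
  have "A \<notin> P" using sub cA by blast
  define ctr' where "ctr' = ctr(A := c)"
  have ctr': "ctr' A = c" "\<And>S. S \<in> P \<Longrightarrow> ctr' S = ctr S"
    using \<open>A \<notin> P\<close> by (auto simp: ctr'_def)
  have part: "partition_on (R \<union> B) (insert A P)"
    using P(1) A cA sub by (auto simp: partition_on_def disjoint_def)
  have blocks: "k13_block R B S (ctr' S)" if "S \<in> insert A P" for S
    using that block P(2)[of S] ctr' by (auto simp: k13_block_def)
  have star: "star_segments (insert A P) ctr' = {(c, x) |x. x \<in> A - {c}} \<union> star_segments P ctr"
    using ctr' by (auto simp: star_segments_def) (metis DiffI singletonD)+
  have old: "\<exists>p q. f = (p, q) \<and> {p, q} \<subseteq> R \<union> B - A" if "f \<in> star_segments P ctr" for f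
    using that sub ctrS by (fastforce simp: star_segments_def)
  have cross: "non_crossing (c, x) f" if "x \<in> A" "f \<in> star_segments P ctr" for x f
    using old[OF that(2)] non_crossing_if_disjoint_hulls[OF hulls] that(1) cA(1) by auto
  have new: "non_crossing (c, x) (c, y)" if "x \<in> A - {c}" "y \<in> A - {c}" "x \<noteq> y" for x y
  proof -
    have "\<not> collinear {x, c, y}"
      using that A cA by (intro general_position_not_collinear[OF gp]) auto
    then have "closed_segment x c \<inter> closed_segment c y = {c}" by (intro Int_closed_segment) simp
    then show ?thesis by (simp add: non_crossing_def closed_segment_commute)
  qed
  have "pairwise non_crossing (star_segments (insert A P) ctr')"
    unfolding star
  proof (rule pairwiseI)
    fix e f assume ef: "e \<in> {(c, x) |x. x \<in> A - {c}} \<union> star_segments P ctr"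
      "f \<in> {(c, x) |x. x \<in> A - {c}} \<union> star_segments P ctr" "e \<noteq> f"
    have cross': "non_crossing f (c, x)" if "x \<in> A" "f \<in> star_segments P ctr" for x f
      using cross[OF that] by (simp add: non_crossing_commute)
    from ef show "non_crossing e f"
      by (auto intro: cross cross' new pairwiseD[OF P(3)])
  qed
  then show ?thesis using part blocks unfolding k13_coverable_def by blast
qed

section \<open>Induction by removing stars\<close>

lemma k13_star_remove:
  fixes R B :: "(real^2) set"
  assumes "finite R" "finite B" "general_position (R \<union> B)" "line_separates v t R B"
    and "card R \<ge> 3" "card B \<ge> 1"
  obtains R' B' where "R' \<subseteq> R" "B' \<subseteq> B" "card R' + 3 = card R" "card B' + 1 = card B"
    "k13_coverable R' B' \<Longrightarrow> k13_coverable R B"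
proof -
  obtain u A where A: "u \<noteq> 0" "weakly_cut_off (R \<union> B) u A" "card A = 4" "card (A \<inter> R) = 3"
    using weakly_cut_off_card_three[OF assms] by blast
  have disj: "R \<inter> B = {}" using assms(4) by (fastforce simp: line_separates_def)
  have sub: "A \<subseteq> R \<union> B" using A(2) by (simp add: weakly_cut_off_def)
  have fin: "finite A" using A(3) by (auto intro: card_ge_0_finite)
  have "card A = card (A \<inter> R) + card (A \<inter> B)"
    using sub disj fin by (subst card_Un_disjoint[symmetric]) (auto intro: arg_cong[where f = card])
  then have blue: "card (A \<inter> B) = 1" using A by simp
  \<comment> \<open>The only blue point of \<open>A\<close> becomes the center of the three red
    ones.\<close>
  then obtain c where c: "A \<inter> B = {c}" by (auto simp: card_1_singleton_iff)
  have "k13_block R B A c" using A c sub by (auto simp: k13_block_def)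
  then have "k13_coverable (R - A) (B - A) \<Longrightarrow> k13_coverable R B"
    using k13_coverable_add_star[OF assms(3) sub] weakly_cut_off_disjoint_hulls[OF _ assms(3) A(1,2)] assms(1,2)
    by simp
  moreover have "card (R - A) + 3 = card R" "card (B - A) + 1 = card B"
    using A(4) blue fin assms(5,6) by (simp_all add: card_Diff_subset_Int Int_commute)
  ultimately show ?thesis using that[of "R - A" "B - A"] by blast
qed

theorem theorem6:
  fixes g h :: nat and R B :: "(real^2) set"
  assumes "finite R" and "card R = 3 * g + h"
    and "finite B" and "card B = 3 * h + g"
    and "general_position (R \<union> B)"
    and "\<exists>v t. line_separates v t R B"
  shows "k13_coverable R B"
  using assms
\<comment> \<open>Removing a star with a blue center lowers \<open>g\<close> by one and keeps
  \<open>h\<close>; a red center does the reverse. The cardinalities keep their form.\<close>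
proof (induction "g + h" arbitrary: g h R B)
  case 0
  then have "R = {}" "B = {}" by auto
  then show ?case by (auto simp: k13_coverable_def star_segments_def partition_on_def)
next
  case (Suc n)
  obtain v t where sep: "line_separates v t R B" using Suc.prems by blast
  show ?case
  proof (cases g)
    case (Suc g')
    then have "card R \<ge> 3" "card B \<ge> 1" using Suc.prems by auto
    then obtain R' B' where *: "R' \<subseteq> R" "B' \<subseteq> B" "card R' + 3 = card R" "card B' + 1 = card B"
      "k13_coverable R' B' \<Longrightarrow> k13_coverable R B"
      using k13_star_remove[OF Suc.prems(1,3,5) sep] by blast
    have "k13_coverable R' B'"
    proof (rule Suc.hyps(1)[of g' h])
      show "general_position (R' \<union> B')"
        using Suc.prems(5) by (rule general_position_subset) (use *(1,2) in blast)
    qed (use Suc.hyps(2) Suc Suc.prems * in \<open>auto intro: finite_subset line_separates_subset[OF sep]\<close>)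
    then show ?thesis by (rule *(5))
  next
    case 0
    \<comment> \<open>With \<open>g = 0\<close> the colors exchange roles; negating the normal puts
      \<open>B\<close> on the side where the removal lemma expects its three leaves.\<close>
    then obtain h' where h: "h = Suc h'" using Suc.hyps(2) by (cases h) auto
    then have "card B \<ge> 3" "card R \<ge> 1" using Suc.prems by auto
    then obtain B' R' where *: "B' \<subseteq> B" "R' \<subseteq> R" "card B' + 3 = card B" "card R' + 1 = card R"
      "k13_coverable B' R' \<Longrightarrow> k13_coverable B R"
      using k13_star_remove[OF Suc.prems(3,1) _ line_separates_commute[OF sep]] Suc.prems(5)
      by (metis Un_commute)
    have "k13_coverable R' B'"
    proof (rule Suc.hyps(1)[of g h'])
      show "general_position (R' \<union> B')"
        using Suc.prems(5) by (rule general_position_subset) (use *(1,2) in blast)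
    qed (use Suc.hyps(2) h Suc.prems * in \<open>auto intro: finite_subset line_separates_subset[OF sep]\<close>)
    then show ?thesis using *(5) k13_coverable_commute by metis
  qed
qed

end
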